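(* Let $F$ be a finite field of characteristic $p$ with $|F|=q=p^k$ and let $G=D_{12} \times C_2$. If $p>3$, then $$U(FG) \cong C_{p^k-1}^8 \times GL(2,F)^4, \quad \text{if } q \equiv \pm 1 \bmod 6.$$
   Context: $FG$ denotes the group algebra of a finite group $G$ over $F$, and $U(FG)$ its group of units. $C_n$ is the cyclic group of order $n$, $D_n$ is the dihedral group of order $n$ (so $D_{12}$ has order $12$), and $H^m$ denotes the direct product of $m$ copies of a group $H$. *)

theory Defs
  imports
    "HOL-Algebra.Elementary_Groups"
    "HOL-Algebra.Product_Groups"
    "HOL-Library.Cardinality"
    "HOL-Number_Theory.Cong"
    "Jordan_Normal_Form.Matrix"
begin

(* The formal sum over x of a(x) x is encoded by its coefficient function a, extended by 0
   outside carrier G. Intended for finite G; no finiteness of supports is imposed. *)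
definition group_algebra ::
    "'f::comm_ring_1 itself \<Rightarrow> ('g, 'm) monoid_scheme \<Rightarrow> ('f, 'g \<Rightarrow> 'f) module" where
  "group_algebra F G =
     \<lparr>carrier = {a. \<forall>x. x \<notin> carrier G \<longrightarrow> a x = 0},
      monoid.mult = (\<lambda>a b x. \<Sum>(y, z)\<in>{(y, z) \<in> carrier G \<times> carrier G. y \<otimes>\<^bsub>G\<^esub> z = x}. a y * b z),
      one = (\<lambda>x. if x = \<one>\<^bsub>G\<^esub> then 1 else 0),
      zero = (\<lambda>x. 0),
      add = (\<lambda>a b x. a x + b x),
      smult = (\<lambda>c a x. c * a x)\<rparr>"

(* D_n is indexed by its order n (even, positive), not by the number of sides m = n div 2.
   (i, e) stands for r^i s^e with r^m = s^2 = 1 and s r = r^(-1) s. *)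
definition dihedral_group :: "nat \<Rightarrow> (int \<times> bool) monoid" where
  "dihedral_group n =
     \<lparr>carrier = {0..<int (n div 2)} \<times> UNIV,
      monoid.mult = (\<lambda>(i, e) (j, e'). ((if e then i - j else i + j) mod int (n div 2), e \<noteq> e')),
      one = (0, False)\<rparr>"

definition general_linear_group :: "'f::comm_ring_1 itself \<Rightarrow> nat \<Rightarrow> 'f mat monoid" where
  "general_linear_group F n = units_of (ring_mat F n ())"

definition group_power :: "('g, 'm) monoid_scheme \<Rightarrow> nat \<Rightarrow> (nat \<Rightarrow> 'g) monoid" where
  "group_power H m = product_group {..<m} (\<lambda>_. H)"

lemma group_dihedral_group:
  assumes "2 \<le> n"
  shows "group (dihedral_group n)"
proof -
  define m where "m = int (n div 2)"
  have m: "0 < m" using assms by (simp add: m_def)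
  show ?thesis
  proof (rule groupI)
    fix x y z
    assume "x \<in> carrier (dihedral_group n)" "y \<in> carrier (dihedral_group n)"
      "z \<in> carrier (dihedral_group n)"
    then show "x \<otimes>\<^bsub>dihedral_group n\<^esub> y \<otimes>\<^bsub>dihedral_group n\<^esub> z =
      x \<otimes>\<^bsub>dihedral_group n\<^esub> (y \<otimes>\<^bsub>dihedral_group n\<^esub> z)"
      by (cases x; cases y; cases z)
        (auto simp: dihedral_group_def mod_simps algebra_simps)
  next
    fix x assume x: "x \<in> carrier (dihedral_group n)"
    obtain i e where xe: "x = (i, e)" by (cases x)
    let ?y = "(if e then i else (- i) mod m, e)"
    have "?y \<in> carrier (dihedral_group n)" "?y \<otimes>\<^bsub>dihedral_group n\<^esub> x = \<one>\<^bsub>dihedral_group n\<^esub>"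
      using x m by (auto simp: xe dihedral_group_def m_def[symmetric] mod_simps)
    then show "\<exists>y\<in>carrier (dihedral_group n). y \<otimes>\<^bsub>dihedral_group n\<^esub> x = \<one>\<^bsub>dihedral_group n\<^esub>"
      by blast
  qed (use m in \<open>auto simp: dihedral_group_def m_def[symmetric]\<close>)
qed

lemma order_dihedral_group:
  assumes "even n"
  shows "order (dihedral_group n) = n"
  using assms by (auto simp: order_def dihedral_group_def card_cartesian_product elim!: evenE)

lemma ring_group_algebra:
  fixes G (structure)
  assumes "group G" "finite (carrier G)"
  shows "ring (group_algebra TYPE('f::comm_ring_1) G)"
proof -
  interpret group G by fact
  let ?A = "group_algebra TYPE('f) G"
  let ?C = "carrier G"
  have mult: "(a \<otimes>\<^bsub>?A\<^esub> b) x = (\<Sum>y\<in>?C. a y * b (inv y \<otimes> x))" if "x \<in> ?C" for a b x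
    unfolding group_algebra_def monoid.simps
    by (rule sum.reindex_bij_witness[of _ "\<lambda>y. (y, inv y \<otimes> x)" fst])
      (use that in \<open>auto simp: m_assoc[symmetric] inv_solve_left'\<close>)
  have mult0: "(a \<otimes>\<^bsub>?A\<^esub> b) x = 0" if "x \<notin> ?C" for a b x
  proof -
    have e: "{(y, z) \<in> ?C \<times> ?C. y \<otimes> z = x} = {}" using that by auto
    show ?thesis unfolding group_algebra_def monoid.simps e by simp
  qed
  have car: "a \<in> carrier ?A \<longleftrightarrow> (\<forall>x. x \<notin> ?C \<longrightarrow> a x = 0)" for a
    by (simp add: group_algebra_def)
  have oneA: "\<one>\<^bsub>?A\<^esub> = (\<lambda>x. if x = \<one> then 1 else 0)" by (simp add: group_algebra_def)
  have addA: "a \<oplus>\<^bsub>?A\<^esub> b = (\<lambda>x. a x + b x)" for a b by (simp add: group_algebra_def)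
  have zeroA: "\<zero>\<^bsub>?A\<^esub> = (\<lambda>x. 0)" by (simp add: group_algebra_def)
  show ?thesis
  proof (rule ringI)
    show "abelian_group ?A"
    proof (rule abelian_groupI)
      fix a assume a: "a \<in> carrier ?A"
      show "\<exists>b\<in>carrier ?A. b \<oplus>\<^bsub>?A\<^esub> a = \<zero>\<^bsub>?A\<^esub>"
        by (rule bexI[of _ "\<lambda>x. - a x"]) (use a in \<open>auto simp: car addA zeroA\<close>)
    qed (auto simp: car addA zeroA algebra_simps)
  next
    show "monoid ?A"
    proof (rule monoidI)
      fix a b c assume abc: "a \<in> carrier ?A" "b \<in> carrier ?A" "c \<in> carrier ?A"
      show "a \<otimes>\<^bsub>?A\<^esub> b \<otimes>\<^bsub>?A\<^esub> c = a \<otimes>\<^bsub>?A\<^esub> (b \<otimes>\<^bsub>?A\<^esub> c)"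
      proof
        fix x show "(a \<otimes>\<^bsub>?A\<^esub> b \<otimes>\<^bsub>?A\<^esub> c) x = (a \<otimes>\<^bsub>?A\<^esub> (b \<otimes>\<^bsub>?A\<^esub> c)) x"
        proof (cases "x \<in> ?C")
          case x: True
          have "(a \<otimes>\<^bsub>?A\<^esub> b \<otimes>\<^bsub>?A\<^esub> c) x =
              (\<Sum>y\<in>?C. \<Sum>u\<in>?C. a u * b (inv u \<otimes> y) * c (inv y \<otimes> x))"
            by (simp add: mult x sum_distrib_right cong: sum.cong)
          also have "\<dots> = (\<Sum>u\<in>?C. \<Sum>y\<in>?C. a u * b (inv u \<otimes> y) * c (inv y \<otimes> x))"
            by (rule sum.swap)
          also have "\<dots> = (\<Sum>u\<in>?C. \<Sum>v\<in>?C. a u * (b v * c (inv v \<otimes> (inv u \<otimes> x))))"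
          proof (rule sum.cong[OF refl])
            fix u assume u: "u \<in> ?C"
            have canc: "y \<otimes> u \<otimes> inv u = y" if "y \<in> ?C" for y
              using u that by (simp add: m_assoc)
            show "(\<Sum>y\<in>?C. a u * b (inv u \<otimes> y) * c (inv y \<otimes> x)) =
                (\<Sum>v\<in>?C. a u * (b v * c (inv v \<otimes> (inv u \<otimes> x))))"
              by (rule sum.reindex_bij_witness[of _ "\<lambda>v. u \<otimes> v" "\<lambda>y. inv u \<otimes> y"])
                (use u x in \<open>auto simp: m_assoc[symmetric] inv_mult_group mult.assoc canc\<close>)
          qed
          also have "\<dots> = (a \<otimes>\<^bsub>?A\<^esub> (b \<otimes>\<^bsub>?A\<^esub> c)) x"
            by (simp add: mult x sum_distrib_left cong: sum.cong)
          finally show ?thesis .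
        qed (simp add: mult0)
      qed
    next
      fix a assume a: "a \<in> carrier ?A"
      show "\<one>\<^bsub>?A\<^esub> \<otimes>\<^bsub>?A\<^esub> a = a"
      proof
        fix x show "(\<one>\<^bsub>?A\<^esub> \<otimes>\<^bsub>?A\<^esub> a) x = a x"
        proof (cases "x \<in> ?C")
          case True
          then have "(\<one>\<^bsub>?A\<^esub> \<otimes>\<^bsub>?A\<^esub> a) x = (\<Sum>y\<in>?C. if y = \<one> then a x else 0)"
            unfolding mult[OF True] oneA by (intro sum.cong) auto
          then show ?thesis using assms by simp
        qed (use a in \<open>simp add: mult0 car\<close>)
      qed
      show "a \<otimes>\<^bsub>?A\<^esub> \<one>\<^bsub>?A\<^esub> = a"
      proof
        fix x show "(a \<otimes>\<^bsub>?A\<^esub> \<one>\<^bsub>?A\<^esub>) x = a x"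
        proof (cases "x \<in> ?C")
          case True
          have "inv y \<otimes> x = \<one> \<longleftrightarrow> y = x" if "y \<in> ?C" for y
            using that True by (metis inv_closed inv_equality inv_inv l_inv)
          then have "(a \<otimes>\<^bsub>?A\<^esub> \<one>\<^bsub>?A\<^esub>) x = (\<Sum>y\<in>?C. if y = x then a x else 0)"
            unfolding mult[OF True] oneA by (intro sum.cong) auto
          then show ?thesis using assms True by simp
        qed (use a in \<open>simp add: mult0 car\<close>)
      qed
    qed (auto simp: car mult0 oneA)
  next
    fix a b c assume "a \<in> carrier ?A" "b \<in> carrier ?A" "c \<in> carrier ?A"
    show "(a \<oplus>\<^bsub>?A\<^esub> b) \<otimes>\<^bsub>?A\<^esub> c = a \<otimes>\<^bsub>?A\<^esub> c \<oplus>\<^bsub>?A\<^esub> b \<otimes>\<^bsub>?A\<^esub> c"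
      by (rule ext, unfold addA, rename_tac x, case_tac "x \<in> ?C")
        (simp_all add: mult mult0 distrib_right sum.distrib)
    show "c \<otimes>\<^bsub>?A\<^esub> (a \<oplus>\<^bsub>?A\<^esub> b) = c \<otimes>\<^bsub>?A\<^esub> a \<oplus>\<^bsub>?A\<^esub> c \<otimes>\<^bsub>?A\<^esub> b"
      by (rule ext, unfold addA, rename_tac x, case_tac "x \<in> ?C")
        (simp_all add: mult mult0 distrib_left sum.distrib)
  qed
qed

end

theory Submission
  imports Defs "HOL-Algebra.Multiplicative_Group"
begin

text \<open>
  Since \<open>2\<close> is invertible in \<open>F\<close>, the group algebra \<open>F[G \<times> C\<^sub>2]\<close> splits as \<open>F[G] \<times> F[G]\<close>, by
  sending the generator of \<open>C\<^sub>2\<close> to \<open>1\<close> and to \<open>-1\<close>. As \<open>D\<^sub>1\<^sub>2\<close> is isomorphic to \<open>D\<^sub>6 \<times> C\<^sub>2\<close>, two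
  such splittings reduce the problem to four copies of \<open>F[D\<^sub>6]\<close>, which is \<open>F \<times> F \<times> M\<^sub>2(F)\<close> because
  \<open>6\<close> is invertible and the two-dimensional representation of \<open>D\<^sub>6\<close> is defined over the prime field.
  Its unit group is thus \<open>F\<^sup>* \<times> F\<^sup>* \<times> GL(2, F)\<close>, where \<open>F\<^sup>*\<close> is cyclic of order \<open>q - 1\<close>. Only the
  multiplicative structure of the algebras matters for their units, so all isomorphisms below are
  isomorphisms of multiplicative monoids.
\<close>

section \<open>Units of monoids\<close>

text \<open>For monoids, \<open>hom\<close> requires only multiplicativity. Preservation of the unit
  element is therefore derived from surjectivity, and inverses are transported in both
  directions.\<close>

lemma units_of_iso:
  assumes "monoid M" "monoid N" "M \<cong> N"
  shows "units_of M \<cong> units_of N"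
proof -
  interpret M: monoid M by fact
  interpret N: monoid N by fact
  obtain f where f: "f \<in> hom M N" and bij: "bij_betw f (carrier M) (carrier N)"
    using assms(3) by (auto simp: is_iso_def iso_def)
  have inj: "inj_on f (carrier M)" and surj: "f ` carrier M = carrier N"
    using bij by (auto simp: bij_betw_def)
  have mult: "f (x \<otimes>\<^bsub>M\<^esub> y) = f x \<otimes>\<^bsub>N\<^esub> f y" if "x \<in> carrier M" "y \<in> carrier M" for x y
    using f that by (simp add: hom_mult)
  \<comment> \<open>The preimage \<open>e\<close> of the unit of \<open>N\<close> gives f(1) = f(1)
    f(e) = f(1 e) = f(e) = 1.\<close>
  obtain e where e: "e \<in> carrier M" "f e = \<one>\<^bsub>N\<^esub>"
    using surj by (metis N.one_closed imageE)
  have one: "f \<one>\<^bsub>M\<^esub> = \<one>\<^bsub>N\<^esub>"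
    using mult[of "\<one>\<^bsub>M\<^esub>" e] e hom_in_carrier[OF f, of "\<one>\<^bsub>M\<^esub>"] by simp
  have "f ` Units M = Units N"
  proof
    show "f ` Units M \<subseteq> Units N"
    proof
      fix y assume "y \<in> f ` Units M"
      then obtain x where x: "x \<in> Units M" "y = f x" by blast
      have "f x \<otimes>\<^bsub>N\<^esub> f (inv\<^bsub>M\<^esub> x) = \<one>\<^bsub>N\<^esub>" "f (inv\<^bsub>M\<^esub> x) \<otimes>\<^bsub>N\<^esub> f x = \<one>\<^bsub>N\<^esub>"
        using x one mult[of x "inv\<^bsub>M\<^esub> x"] mult[of "inv\<^bsub>M\<^esub> x" x] by (simp_all add: M.Units_closed)
      then show "y \<in> Units N"
        using x f M.Units_closed[of x] M.Units_inv_closed[of x]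
        unfolding Units_def[of N] by (auto simp: hom_in_carrier)
    qed
    show "Units N \<subseteq> f ` Units M"
    proof
      fix y assume y: "y \<in> Units N"
      obtain x x' where x: "x \<in> carrier M" "f x = y" "x' \<in> carrier M" "f x' = inv\<^bsub>N\<^esub> y"
        using y surj by (metis N.Units_closed N.Units_inv_closed imageE)
      have "f (x \<otimes>\<^bsub>M\<^esub> x') = f \<one>\<^bsub>M\<^esub>" "f (x' \<otimes>\<^bsub>M\<^esub> x) = f \<one>\<^bsub>M\<^esub>"
        using x y one by (simp_all add: mult)
      then have "x \<otimes>\<^bsub>M\<^esub> x' = \<one>\<^bsub>M\<^esub>" "x' \<otimes>\<^bsub>M\<^esub> x = \<one>\<^bsub>M\<^esub>"
        using inj x by (simp_all add: inj_on_eq_iff)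
      then show "y \<in> f ` Units M"
        using x by (auto simp: Units_def)
    qed
  qed
  moreover have "inj_on f (Units M)"
    using inj by (rule inj_on_subset) (simp add: subsetI M.Units_closed)
  ultimately have "f \<in> iso (units_of M) (units_of N)"
    using mult by (auto simp: iso_iff hom_def units_of_def M.Units_closed)
  then show ?thesis by (rule is_isoI)
qed

lemma Units_DirProd: "Units (M \<times>\<times> N) = Units M \<times> Units N"
  by (fastforce simp: Units_def)

lemma units_of_DirProd: "units_of (M \<times>\<times> N) = units_of M \<times>\<times> units_of N"
  by (simp add: units_of_def DirProd_def Units_DirProd[unfolded DirProd_def])

section \<open>Group algebras\<close>

text \<open>A pair (y, z) with y z = x is determined by y, since z = y^-1 x; this turns the product
  into a convolution over a single variable.\<close>

lemma group_algebra_mult: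
  fixes G (structure)
  assumes "group G" "x \<in> carrier G"
  shows "(a \<otimes>\<^bsub>group_algebra T G\<^esub> b) x = (\<Sum>y\<in>carrier G. a y * b (inv y \<otimes> x))"
proof -
  interpret group G by fact
  show ?thesis
    unfolding group_algebra_def monoid.simps
    by (rule sum.reindex_bij_witness[of _ "\<lambda>y. (y, inv y \<otimes> x)" fst])
      (use assms(2) in \<open>auto simp: m_assoc[symmetric] inv_solve_left'\<close>)
qed

lemma group_algebra_mult_notin:
  assumes "group G" "x \<notin> carrier G"
  shows "(a \<otimes>\<^bsub>group_algebra T G\<^esub> b) x = 0"
proof -
  interpret group G by fact
  have "{(y, z) \<in> carrier G \<times> carrier G. y \<otimes>\<^bsub>G\<^esub> z = x} = {}" using assms(2) by auto
  then show ?thesis unfolding group_algebra_def monoid.simps by (metis sum.empty)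
qed

lemma carrier_group_algebra:
  "carrier (group_algebra T G) = {a. \<forall>x. x \<notin> carrier G \<longrightarrow> a x = 0}"
  by (simp add: group_algebra_def)

text \<open>Coefficient functions pull back along group isomorphisms. The isomorphism is therefore
  taken from \<open>H\<close> to \<open>G\<close>, and \<open>?f\<close> composes with it, extending
  by 0 outside \<open>carrier H\<close>.\<close>

lemma group_algebra_cong:
  assumes "group G" "group H" "G \<cong> H"
  shows "group_algebra T G \<cong> group_algebra T H"
proof -
  interpret G: group G by fact
  interpret H: group H by fact
  obtain h where h: "h \<in> iso H G" using G.iso_sym[OF assms(3)] by (auto simp: is_iso_def)
  interpret h: group_hom H G h
    by unfold_locales (use h in \<open>simp add: iso_def\<close>)
  have bij: "bij_betw h (carrier H) (carrier G)" using h by (simp add: iso_def)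
  let ?f = "\<lambda>a x. if x \<in> carrier H then a (h x) else 0"
  let ?g = "\<lambda>b y. if y \<in> carrier G then b (inv_into (carrier H) h y) else 0"
  have "?f (a \<otimes>\<^bsub>group_algebra T G\<^esub> b) = ?f a \<otimes>\<^bsub>group_algebra T H\<^esub> ?f b" for a b
  proof
    fix x
    show "?f (a \<otimes>\<^bsub>group_algebra T G\<^esub> b) x = (?f a \<otimes>\<^bsub>group_algebra T H\<^esub> ?f b) x"
    proof (cases "x \<in> carrier H")
      case True
      then have "?f (a \<otimes>\<^bsub>group_algebra T G\<^esub> b) x =
          (\<Sum>y\<in>carrier G. a y * b (inv\<^bsub>G\<^esub> y \<otimes>\<^bsub>G\<^esub> h x))"
        by (simp add: group_algebra_mult assms)
      also have "\<dots> = (\<Sum>y\<in>carrier H. a (h y) * b (inv\<^bsub>G\<^esub> h y \<otimes>\<^bsub>G\<^esub> h x))"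
        by (rule sum.reindex_bij_betw[OF bij, symmetric])
      also have "\<dots> = (?f a \<otimes>\<^bsub>group_algebra T H\<^esub> ?f b) x"
        using True by (simp add: group_algebra_mult assms cong: sum.cong)
      finally show ?thesis .
    qed (simp add: group_algebra_mult_notin assms)
  qed
  then have "?f \<in> hom (group_algebra T G) (group_algebra T H)"
    by (auto simp: hom_def carrier_group_algebra)
  moreover have "bij_betw ?f (carrier (group_algebra T G)) (carrier (group_algebra T H))"
    by (rule bij_betw_byWitness[of _ ?g])
      (use bij in \<open>auto simp: carrier_group_algebra fun_eq_iff bij_betw_inv_into_right
        bij_betw_inv_into_left bij_betw_apply[OF bij_betw_inv_into[OF bij]] bij_betw_apply[OF bij]\<close>)
  ultimately show ?thesis by (auto simp: is_iso_def iso_def)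
qed

lemma sum_carrier_DirProd_C2:
  "(\<Sum>y\<in>carrier (G \<times>\<times> integer_mod_group 2). f y) = (\<Sum>y\<in>carrier G. f (y, 0) + f (y, 1))"
proof -
  have C2: "carrier (integer_mod_group 2) = {0, 1}"
    by (auto simp: carrier_integer_mod_group)
  show ?thesis
    by (simp add: C2 sum.cartesian_product')
qed

lemma group_algebra_DirProd_C2:
  fixes G :: "('g, 'm) monoid_scheme"
  assumes "group G" "(2 :: 'f::field) \<noteq> 0"
  shows "group_algebra TYPE('f) (G \<times>\<times> integer_mod_group 2) \<cong>
    group_algebra TYPE('f) G \<times>\<times> group_algebra TYPE('f) G"
proof -
  let ?C = "integer_mod_group 2"
  let ?A = "group_algebra TYPE('f) (G \<times>\<times> ?C)" and ?B = "group_algebra TYPE('f) G"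
  interpret G: group G by fact
  have grp: "group (G \<times>\<times> ?C)" by (simp add: DirProd_group assms(1))
  have C2: "carrier ?C = {0, 1}" by (auto simp: carrier_integer_mod_group)
  \<comment> \<open>\<open>f\<close> evaluates the generator of the second factor at 1 and at -1;
    \<open>g\<close> recovers the two coefficients as half the sum and half the difference.\<close>
  define f where "f a = (\<lambda>x. a (x, 0) + a (x, 1), \<lambda>x. a (x, 0) - a (x, 1))" for a :: "'g \<times> int \<Rightarrow> 'f"
  define g where "g bc = (\<lambda>(x, c :: int). if c = 0 then (fst bc x + snd bc x) / 2
      else if c = 1 then (fst bc x - snd bc x) / 2 else 0)"
    for bc :: "('g \<Rightarrow> 'f) \<times> ('g \<Rightarrow> 'f)"
  \<comment> \<open>The convolution sum is grouped by the component in \<open>G\<close>. For c in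
    {0, 1}, adding 1 modulo 2 is the same as forming 1 - c.\<close>
  have val: "(a \<otimes>\<^bsub>?A\<^esub> b) (x, c) = (\<Sum>y\<in>carrier G. a (y, 0) * b (inv\<^bsub>G\<^esub> y \<otimes>\<^bsub>G\<^esub> x, c)
      + a (y, 1) * b (inv\<^bsub>G\<^esub> y \<otimes>\<^bsub>G\<^esub> x, 1 - c))"
    if "x \<in> carrier G" "c \<in> {0, 1}" for a b x c
  proof -
    have "(x, c) \<in> carrier (G \<times>\<times> ?C)" using that by (simp add: C2)
    then show ?thesis
      using that
      by (auto simp: group_algebra_mult grp sum_carrier_DirProd_C2 inv_DirProd assms(1) C2
        simp del: carrier_DirProd intro!: sum.cong)
  qed
  have mult: "f (a \<otimes>\<^bsub>?A\<^esub> b) = f a \<otimes>\<^bsub>?B \<times>\<times> ?B\<^esub> f b" for a b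
  proof -
    have "fst (f (a \<otimes>\<^bsub>?A\<^esub> b)) x = (fst (f a) \<otimes>\<^bsub>?B\<^esub> fst (f b)) x \<and>
        snd (f (a \<otimes>\<^bsub>?A\<^esub> b)) x = (snd (f a) \<otimes>\<^bsub>?B\<^esub> snd (f b)) x" for x
    proof (cases "x \<in> carrier G")
      case True
      then show ?thesis
        by (simp add: f_def val group_algebra_mult assms(1) sum.distrib[symmetric]
          sum_subtractf[symmetric] algebra_simps)
    next
      case False
      then show ?thesis
        by (simp add: f_def group_algebra_mult_notin grp assms(1))
    qed
    then have "fst (f (a \<otimes>\<^bsub>?A\<^esub> b)) = fst (f a) \<otimes>\<^bsub>?B\<^esub> fst (f b)"
      "snd (f (a \<otimes>\<^bsub>?A\<^esub> b)) = snd (f a) \<otimes>\<^bsub>?B\<^esub> snd (f b)"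
      by auto
    then show ?thesis
      by (metis mult_DirProd surjective_pairing)
  qed
  \<comment> \<open>Adding two halves over a common denominator produces the denominator 4.\<close>
  have four: "(4 :: 'f) \<noteq> 0"
    using assms(2) by (metis mult_eq_0_iff numeral_Bit0 mult_2)
  have "f \<in> hom ?A (?B \<times>\<times> ?B)"
    unfolding hom_def using mult by (auto simp: f_def carrier_group_algebra simp del: mult_DirProd)
  moreover have "bij_betw f (carrier ?A) (carrier (?B \<times>\<times> ?B))"
    by (rule bij_betw_byWitness[of _ g])
      (use assms(2) four in \<open>auto simp: f_def g_def carrier_group_algebra C2 fun_eq_iff field_simps\<close>)
  ultimately show ?thesis by (auto simp: is_iso_def iso_def)
qed

section \<open>Dihedral groups\<close>

lemma carrier_dihedral_group: "carrier (dihedral_group n) = {0..<int (n div 2)} \<times> UNIV"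
  by (simp add: dihedral_group_def)

lemma mult_dihedral_group:
  "(i, e) \<otimes>\<^bsub>dihedral_group n\<^esub> (j, e') = ((if e then i - j else i + j) mod int (n div 2), e \<noteq> e')"
  by (simp add: dihedral_group_def)

lemma inv_dihedral_group:
  assumes "2 \<le> n" "(i, e) \<in> carrier (dihedral_group n)"
  shows "inv\<^bsub>dihedral_group n\<^esub> (i, e) = (if e then i else (- i) mod int (n div 2), e)"
proof (rule group.inv_equality[OF group_dihedral_group[OF assms(1)]])
  show "(if e then i else (- i) mod int (n div 2), e) \<otimes>\<^bsub>dihedral_group n\<^esub> (i, e) = \<one>\<^bsub>dihedral_group n\<^esub>"
    by (auto simp: dihedral_group_def mod_simps)
qed (use assms in \<open>auto simp: carrier_dihedral_group\<close>)

text \<open>For odd \<open>m\<close> the Chinese remainder theorem splits the rotations C_2m as C_m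
  x C_2. Reflections invert rotations, which is trivial on C_2, so this factor is central and splits
  off.\<close>

lemma dihedral_group_iso_DirProd_C2:
  assumes "odd m"
  shows "dihedral_group (4 * m) \<cong> dihedral_group (2 * m) \<times>\<times> integer_mod_group 2"
proof -
  have m: "0 < m" using assms by (rule odd_pos)
  let ?f = "\<lambda>(i, e :: bool). ((i mod int m, e), i mod 2)"
  have C2: "carrier (integer_mod_group 2) = {0, 1}"
    by (auto simp: carrier_integer_mod_group)
  have red: "x mod (2 * int m) mod int m = x mod int m" "x mod (2 * int m) mod 2 = x mod 2" for x
    by (simp_all add: mod_mod_cancel)
  have "?f \<in> hom (dihedral_group (4 * m)) (dihedral_group (2 * m) \<times>\<times> integer_mod_group 2)"
  proof (rule homI)
    fix x assume "x \<in> carrier (dihedral_group (4 * m))"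
    then show "?f x \<in> carrier (dihedral_group (2 * m) \<times>\<times> integer_mod_group 2)"
      using m by (auto simp: carrier_dihedral_group C2)
  next
    \<comment> \<open>Modulo 2 the sign of the exponent disappears, so the second component of
      \<open>?f\<close> is additive even when the left factor is a reflection.\<close>
    have parity: "(i - j) mod 2 = (i mod 2 + j mod 2) mod 2" for i j :: int
      by presburger
    fix x y
    show "?f (x \<otimes>\<^bsub>dihedral_group (4 * m)\<^esub> y) =
      ?f x \<otimes>\<^bsub>dihedral_group (2 * m) \<times>\<times> integer_mod_group 2\<^esub> ?f y"
      by (cases x; cases y) (auto simp: mult_dihedral_group red mod_simps parity)
  qed
  moreover have inj: "inj_on ?f (carrier (dihedral_group (4 * m)))"
  proof (rule inj_onI, clarsimp simp: carrier_dihedral_group)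
    fix i j
    assume ij: "0 \<le> i" "i < 2 * int m" "0 \<le> j" "j < 2 * int m"
      and "i mod int m = j mod int m" "i mod 2 = j mod 2"
    then have "int m dvd i - j" "2 dvd i - j" by (simp_all add: mod_eq_dvd_iff)
    moreover have "coprime 2 (int m)" using assms by simp
    ultimately have "2 * int m dvd i - j" by (simp add: divides_mult)
    then have "i mod (2 * int m) = j mod (2 * int m)" by (simp add: mod_eq_dvd_iff)
    then show "i = j" using ij by simp
  qed
  moreover have "?f ` carrier (dihedral_group (4 * m)) =
      carrier (dihedral_group (2 * m) \<times>\<times> integer_mod_group 2)"
  \<comment> \<open>Surjectivity follows by counting: both groups have 4m elements and
    \<open>?f\<close> is injective.\<close>
  proof (rule card_subset_eq)
    show "card (?f ` carrier (dihedral_group (4 * m))) =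
      card (carrier (dihedral_group (2 * m) \<times>\<times> integer_mod_group 2))"
      unfolding card_image[OF inj] by (simp add: carrier_dihedral_group C2 card_cartesian_product)
  qed (use m in \<open>auto simp: carrier_dihedral_group C2\<close>)
  ultimately show ?thesis
    by (intro is_isoI) (simp add: iso_iff)
qed

section \<open>The group algebra of the dihedral group of order six\<close>

text \<open>Writing a matrix through its four entries reduces the matrix identities below to scalar
  ones, by \<open>arg_cong4\<close>.\<close>

definition mat2 :: "'f \<Rightarrow> 'f \<Rightarrow> 'f \<Rightarrow> 'f \<Rightarrow> 'f mat" where
  "mat2 a b c d = mat 2 2 (\<lambda>(i, j). if i = 0 then if j = 0 then a else b else if j = 0 then c else d)"

lemma mat2_carrier [simp]: "mat2 a b c d \<in> carrier_mat 2 2"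
  by (simp add: mat2_def)

lemma mat2_index [simp]:
  "mat2 a b c d $$ (0, 0) = a" "mat2 a b c d $$ (0, Suc 0) = b"
  "mat2 a b c d $$ (Suc 0, 0) = c" "mat2 a b c d $$ (Suc 0, Suc 0) = d"
  by (simp_all add: mat2_def)

lemma mat2_eta:
  "A \<in> carrier_mat 2 2 \<Longrightarrow> mat2 (A $$ (0, 0)) (A $$ (0, 1)) (A $$ (1, 0)) (A $$ (1, 1)) = A"
  by (rule eq_matI) (auto simp: mat2_def less_2_cases_iff)

lemma mat2_mult:
  "mat2 a b c d * mat2 a' b' c' d' =
    mat2 (a * a' + b * c') (a * b' + b * d') (c * a' + d * c') (c * b' + d * (d' :: 'f::comm_ring_1))"
  by (rule eq_matI)
    (auto simp: mat2_def scalar_prod_def less_2_cases_iff numeral_2_eq_2)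

text \<open>This turns the type class field into a record, so that it can be a factor of a direct
  product and the theory of finite fields with explicit carrier applies.\<close>

definition field_ring :: "'f::field itself \<Rightarrow> 'f ring" where
  "field_ring T = \<lparr>carrier = UNIV, monoid.mult = (*), one = 1, zero = 0, add = (+)\<rparr>"

lemma carrier_D6: "carrier (dihedral_group 6) =
    {(0, False), (1, False), (2, False), (0, True), (1, True), (2, True)}"
proof -
  have "{0..<int (6 div 2)} = {0, 1, 2}" by auto
  then show ?thesis by (auto simp: carrier_dihedral_group)
qed

lemma group_algebra_D6:
  assumes "(2 :: 'f::field) \<noteq> 0" "(3 :: 'f) \<noteq> 0"
  shows "group_algebra TYPE('f) (dihedral_group 6) \<cong>
    (field_ring TYPE('f) \<times>\<times> field_ring TYPE('f)) \<times>\<times> ring_mat TYPE('f) 2 ()"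
proof -
  let ?D = "dihedral_group 6" and ?A = "group_algebra TYPE('f) (dihedral_group 6)"
  let ?P = "(field_ring TYPE('f) \<times>\<times> field_ring TYPE('f)) \<times>\<times> ring_mat TYPE('f) 2 ()"
  have grp: "group ?D" by (simp add: group_dihedral_group)
  text \<open>\<open>u\<close> and \<open>v\<close> are the coefficient sums over the rotations and over the reflections, so that
    \<open>u + v\<close> and \<open>u - v\<close> are the linear characters. \<open>M\<close> extends the representation
    \<open>r \<mapsto> mat2 0 (-1) 1 (-1)\<close>, \<open>s \<mapsto> mat2 0 1 1 0\<close>, and \<open>g\<close> is the Fourier inversion formula
    \<open>a x = (\<Sum>\<rho>. dim \<rho> * trace (\<rho> (inv x) * \<rho> a)) / 6\<close>.\<close>
  define u where "u a = a (0, False) + a (1, False) + a (2, False)" for a :: "int \<times> bool \<Rightarrow> 'f"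
  define v where "v a = a (0, True) + a (1, True) + a (2, True)" for a :: "int \<times> bool \<Rightarrow> 'f"
  define M where "M a = mat2
      (a (0, False) - a (2, False) - a (1, True) + a (2, True))
      (- a (1, False) + a (2, False) + a (0, True) - a (2, True))
      (a (1, False) - a (2, False) + a (0, True) - a (1, True))
      (a (0, False) - a (1, False) + a (1, True) - a (2, True))" for a :: "int \<times> bool \<Rightarrow> 'f"
  define f where "f a = ((u a + v a, u a - v a), M a)" for a
  define g where "g = (\<lambda>((s, t), X). \<lambda>x :: int \<times> bool.
      if x = (0, False) then (s + t + 2 * (X $$ (0,0) + X $$ (1,1))) / 6
      else if x = (1, False) then (s + t + 2 * (X $$ (1,0) - X $$ (0,1) - X $$ (0,0))) / 6
      else if x = (2, False) then (s + t + 2 * (X $$ (0,1) - X $$ (1,0) - X $$ (1,1))) / 6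
      else if x = (0, True) then (s - t + 2 * (X $$ (0,1) + X $$ (1,0))) / 6
      else if x = (1, True) then (s - t + 2 * (X $$ (1,1) - X $$ (0,1) - X $$ (0,0))) / 6
      else if x = (2, True) then (s - t + 2 * (X $$ (0,0) - X $$ (1,0) - X $$ (1,1))) / 6
      else 0 :: 'f)"
  have inv: "inv\<^bsub>?D\<^esub> (0, False) = (0, False)" "inv\<^bsub>?D\<^esub> (1, False) = (2, False)"
    "inv\<^bsub>?D\<^esub> (2, False) = (1, False)" "inv\<^bsub>?D\<^esub> (0, True) = (0, True)"
    "inv\<^bsub>?D\<^esub> (1, True) = (1, True)" "inv\<^bsub>?D\<^esub> (2, True) = (2, True)"
    by (simp_all add: inv_dihedral_group carrier_D6)
  \<comment> \<open>The two nontrivial rotations are inverse to each other and each reflection is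
    its own inverse; this gives the six left factors of \<open>x\<close>.\<close>
  have val: "(a \<otimes>\<^bsub>?A\<^esub> b) x = a (0, False) * b x
      + a (1, False) * b ((2, False) \<otimes>\<^bsub>?D\<^esub> x) + a (2, False) * b ((1, False) \<otimes>\<^bsub>?D\<^esub> x)
      + a (0, True) * b ((0, True) \<otimes>\<^bsub>?D\<^esub> x) + a (1, True) * b ((1, True) \<otimes>\<^bsub>?D\<^esub> x)
      + a (2, True) * b ((2, True) \<otimes>\<^bsub>?D\<^esub> x)"
    if "x \<in> carrier ?D" for a b x
  proof -
    have "(0, False) \<otimes>\<^bsub>?D\<^esub> x = x"
      using that by (auto simp: carrier_D6 mult_dihedral_group)
    then show ?thesis
      by (simp add: group_algebra_mult[OF grp that] carrier_D6 inv add.assoc)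
  qed
  have vals:
    "(a \<otimes>\<^bsub>?A\<^esub> b) (0, False) = a (0, False) * b (0, False) + a (1, False) * b (2, False)
      + a (2, False) * b (1, False) + a (0, True) * b (0, True) + a (1, True) * b (1, True)
      + a (2, True) * b (2, True)"
    "(a \<otimes>\<^bsub>?A\<^esub> b) (1, False) = a (0, False) * b (1, False) + a (1, False) * b (0, False)
      + a (2, False) * b (2, False) + a (0, True) * b (2, True) + a (1, True) * b (0, True)
      + a (2, True) * b (1, True)"
    "(a \<otimes>\<^bsub>?A\<^esub> b) (2, False) = a (0, False) * b (2, False) + a (1, False) * b (1, False)
      + a (2, False) * b (0, False) + a (0, True) * b (1, True) + a (1, True) * b (2, True)
      + a (2, True) * b (0, True)"
    "(a \<otimes>\<^bsub>?A\<^esub> b) (0, True) = a (0, False) * b (0, True) + a (1, False) * b (2, True)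
      + a (2, False) * b (1, True) + a (0, True) * b (0, False) + a (1, True) * b (1, False)
      + a (2, True) * b (2, False)"
    "(a \<otimes>\<^bsub>?A\<^esub> b) (1, True) = a (0, False) * b (1, True) + a (1, False) * b (0, True)
      + a (2, False) * b (2, True) + a (0, True) * b (2, False) + a (1, True) * b (0, False)
      + a (2, True) * b (1, False)"
    "(a \<otimes>\<^bsub>?A\<^esub> b) (2, True) = a (0, False) * b (2, True) + a (1, False) * b (1, True)
      + a (2, False) * b (0, True) + a (0, True) * b (1, False) + a (1, True) * b (2, False)
      + a (2, True) * b (0, False)" for a b
    by (simp_all add: val carrier_D6 mult_dihedral_group)
  \<comment> \<open>\<open>u\<close> and \<open>v\<close> are the coefficients of the image of
    \<open>a\<close> in the group algebra of the quotient C_2 by the rotations, hence multiply as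
    there. Multiplicativity of \<open>u + v\<close> and \<open>u - v\<close> follows.\<close>
  have u: "u (a \<otimes>\<^bsub>?A\<^esub> b) = u a * u b + v a * v b"
    and v: "v (a \<otimes>\<^bsub>?A\<^esub> b) = u a * v b + v a * u b" for a b
    by (simp_all add: u_def v_def vals algebra_simps)
  have M: "M (a \<otimes>\<^bsub>?A\<^esub> b) = M a * M b" for a b
    unfolding M_def mat2_mult vals by (rule arg_cong4[where f = mat2]; simp add: algebra_simps)
  have six: "(6 :: 'f) \<noteq> 0"
    using assms mult_eq_0_iff[of "2 :: 'f" 3] by simp
  have "f (a \<otimes>\<^bsub>?A\<^esub> b) = f a \<otimes>\<^bsub>?P\<^esub> f b" for a b
    by (simp add: f_def u v M field_ring_def ring_mat_def algebra_simps)
  then have hom: "f \<in> hom ?A ?P"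
    by (auto simp: hom_def f_def M_def field_ring_def ring_mat_def)
  have "g (f a) = a" if "a \<in> carrier ?A" for a
  proof
    fix x
    have "a x = 0" if "x \<notin> carrier ?D"
      using that \<open>a \<in> carrier ?A\<close> by (cases x) (simp add: carrier_group_algebra)
    then show "g (f a) x = a x"
      using six unfolding f_def g_def M_def u_def v_def
      by (simp add: carrier_D6 divide_eq_eq; simp add: algebra_simps)
  qed
  moreover have "f (g y) = y" if "y \<in> carrier ?P" for y
  proof -
    obtain s t X where y: "y = ((s, t), X)" by (metis surj_pair)
    \<comment> \<open>Summands over the denominator 6 are first merged into one fraction and the
      denominator is cleared; a polynomial identity remains for the second
      \<open>simp\<close>.\<close>
    note combine = add_divide_distrib[symmetric] diff_divide_distrib[symmetric]
      minus_divide_left divide_eq_eq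
    have X: "X \<in> carrier_mat 2 2" using that by (simp add: y ring_mat_def)
    have "M (g y) = mat2 (X $$ (0, 0)) (X $$ (0, 1)) (X $$ (1, 0)) (X $$ (1, 1))"
      unfolding M_def y g_def using six
      by (intro arg_cong4[where f = mat2]; simp add: combine; simp add: algebra_simps)
    moreover have "u (g y) + v (g y) = s" "u (g y) - v (g y) = t"
      unfolding u_def v_def y g_def using six
      by (simp add: combine; simp add: algebra_simps)+
    ultimately show ?thesis
      using mat2_eta[OF X] by (simp add: f_def y)
  qed
  moreover have "g y \<in> carrier ?A" for y
    by (cases y) (auto simp: g_def carrier_group_algebra carrier_D6)
  ultimately have "f \<in> iso ?A ?P"
    by (intro isoI hom bij_betw_byWitness[of _ g])
      (auto intro: hom_in_carrier[OF hom] simp del: carrier_DirProd)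
  then show ?thesis by (rule is_isoI)
qed

section \<open>The multiplicative group of a finite field\<close>

lemma field_field_ring: "field (field_ring (T :: 'f::field itself))"
proof -
  interpret cring "field_ring T"
  proof (rule cringI)
    show "abelian_group (field_ring T)"
    proof (rule abelian_groupI)
      fix x :: 'f
      show "\<exists>y\<in>carrier (field_ring T). y \<oplus>\<^bsub>field_ring T\<^esub> x = \<zero>\<^bsub>field_ring T\<^esub>"
        by (rule bexI[of _ "- x"]) (simp_all add: field_ring_def)
    qed (simp_all add: field_ring_def)
    show "comm_monoid (field_ring T)"
      by (rule comm_monoidI) (simp_all add: field_ring_def)
  qed (simp add: field_ring_def distrib_right)
  show ?thesis
  proof (rule cring_fieldI)
    show "Units (field_ring T) = carrier (field_ring T) - {\<zero>\<^bsub>field_ring T\<^esub>}"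
    proof (intro equalityI subsetI)
      fix x assume "x \<in> carrier (field_ring T) - {\<zero>\<^bsub>field_ring T\<^esub>}"
      then show "x \<in> Units (field_ring T)"
        by (auto simp: Units_def field_ring_def intro!: exI[of _ "inverse x"])
    qed (auto simp: Units_def field_ring_def)
  qed
qed

text \<open>A generator \<open>x\<close> has order |G|, so i -> x^i is well defined and injective on
  exponents modulo |G|.\<close>

lemma (in group) cyclic_group_iso_integer_mod_group:
  assumes "cyclic_group G" "finite (carrier G)"
  shows "G \<cong> integer_mod_group (order G)"
proof -
  obtain x where x: "x \<in> carrier G" and gen: "carrier G = range (\<lambda>n::int. x [^] n)"
    using assms(1) by (auto simp: cyclic_group)
  define n where "n = order G"
  \<comment> \<open>Positivity matters because \<open>integer_mod_group 0\<close> is the infinite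
    group of integers.\<close>
  have n: "n > 0" using assms(2) by (simp add: n_def order_gt_0_iff_finite)
  have "generate G {x} = carrier G"
    using generate_pow[OF x] gen by auto
  then have ord: "ord x = n"
    using generate_pow_card[OF x] by (simp add: n_def order_def)
  have pow_mod: "x [^] (i mod int n) = x [^] i" for i :: int
    using int_pow_eq[OF x] ord by (simp add: minus_mod_eq_mult_div)
  let ?h = "\<lambda>i::int. x [^] i"
  have "?h \<in> hom (integer_mod_group n) G"
    using x by (auto simp: hom_def pow_mod int_pow_mult)
  moreover have "inj_on ?h (carrier (integer_mod_group n))"
  proof (rule inj_onI)
    fix i j assume ij: "i \<in> carrier (integer_mod_group n)" "j \<in> carrier (integer_mod_group n)"
      and "x [^] i = x [^] j"
    then have "j mod int n = i mod int n" using int_pow_eq[OF x] ord by (simp add: mod_eq_dvd_iff)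
    then show "i = j" using ij n by (simp add: carrier_integer_mod_group)
  qed
  moreover have "?h ` carrier (integer_mod_group n) = carrier G"
  proof
    show "carrier G \<subseteq> ?h ` carrier (integer_mod_group n)"
    proof
      fix y assume "y \<in> carrier G"
      then obtain i :: int where "y = x [^] i" using gen by blast
      then have "y = ?h (i mod int n)" by (simp add: pow_mod)
      then show "y \<in> ?h ` carrier (integer_mod_group n)"
        using n by (auto simp: carrier_integer_mod_group)
    qed
  qed (use x in auto)
  ultimately have "integer_mod_group n \<cong> G"
    by (intro is_isoI) (simp add: iso_iff)
  then show ?thesis
    unfolding n_def by (rule group.iso_sym[OF group_integer_mod_group])
qed

lemma units_of_field_ring_iso:
  "units_of (field_ring TYPE('f::{field,finite})) \<cong> integer_mod_group (CARD('f) - 1)"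
proof -
  let ?R = "field_ring TYPE('f)"
  interpret field ?R by (rule field_field_ring)
  interpret U: group "units_of ?R" by (rule units_group)
  have fin: "finite (carrier ?R)" by simp
  have eq: "units_of ?R = mult_of ?R" by (rule mult_of_is_Units[symmetric])
  obtain a where a: "a \<in> carrier (mult_of ?R)"
    and gen: "carrier (mult_of ?R) = {a [^]\<^bsub>?R\<^esub> i | i::nat. i \<in> UNIV}"
    using finite_field_mult_group_has_gen[OF fin] by blast
  have "carrier (units_of ?R) = range (\<lambda>n::int. a [^]\<^bsub>units_of ?R\<^esub> n)"
  proof
    show "range (\<lambda>n::int. a [^]\<^bsub>units_of ?R\<^esub> n) \<subseteq> carrier (units_of ?R)"
      using a by (auto simp: eq[symmetric] U.int_pow_closed simp del: carrier_mult_of)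
    \<comment> \<open>The generator comes with natural powers taken in the ring, whereas
      \<open>cyclic_group\<close> speaks of integer powers in the unit group.\<close>
    have "a [^]\<^bsub>?R\<^esub> i = a [^]\<^bsub>units_of ?R\<^esub> int i" for i :: nat
      unfolding eq by (simp add: int_pow_int nat_pow_mult_of)
    then show "carrier (units_of ?R) \<subseteq> range (\<lambda>n::int. a [^]\<^bsub>units_of ?R\<^esub> n)"
      unfolding eq gen by auto
  qed
  then have "cyclic_group (units_of ?R)"
    unfolding U.cyclic_group by (intro bexI[of _ a]) (use a eq in simp_all)
  moreover have "order (units_of ?R) = CARD('f) - 1"
    unfolding eq order_mult_of[OF fin] by (simp add: order_def field_ring_def)
  ultimately show ?thesis
    using U.cyclic_group_iso_integer_mod_group fin by (metis eq finite_mult_of)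
qed

section \<open>Powers of groups\<close>

lemma group_group_power: "group H \<Longrightarrow> group (group_power H m)"
  by (simp add: group_power_def)

lemma group_power_1_iso: "H \<cong> group_power H 1"
proof -
  have "group_isomorphisms H (group_power H 1) (\<lambda>x. \<lambda>i\<in>{..<1}. x) (\<lambda>z. z 0)"
    by (auto simp: group_isomorphisms_def group_power_def hom_def fun_eq_iff PiE_iff extensional_def)
  then show ?thesis by (intro is_isoI group_isomorphisms_imp_iso)
qed

text \<open>Tuples are concatenated, the second one shifted by \<open>m\<close>. The restrictions
  are there because elements of a product group are extensional functions on the index set.\<close>

lemma group_power_add_iso:
  "group_power H m \<times>\<times> group_power H n \<cong> group_power H (m + n)"
proof -
  let ?f = "\<lambda>(x, y). \<lambda>i\<in>{..<m + n}. if i < m then x i else y (i - m)"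
  let ?g = "\<lambda>z. (\<lambda>i\<in>{..<m}. z i, \<lambda>i\<in>{..<n}. z (m + i))"
  have "group_isomorphisms (group_power H m \<times>\<times> group_power H n) (group_power H (m + n)) ?f ?g"
    by (fastforce simp: group_isomorphisms_def group_power_def hom_def fun_eq_iff PiE_iff
        extensional_def)
  then show ?thesis by (intro is_isoI group_isomorphisms_imp_iso)
qed

lemma DirProd_interchange_iso: "(A \<times>\<times> B) \<times>\<times> (C \<times>\<times> D) \<cong> (A \<times>\<times> C) \<times>\<times> (B \<times>\<times> D)"
proof -
  have "group_isomorphisms ((A \<times>\<times> B) \<times>\<times> (C \<times>\<times> D)) ((A \<times>\<times> C) \<times>\<times> (B \<times>\<times> D))
      (\<lambda>((a, b), (c, d)). ((a, c), (b, d))) (\<lambda>((a, c), (b, d)). ((a, b), (c, d)))"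
    by (auto simp: group_isomorphisms_def hom_def)
  then show ?thesis by (intro is_isoI group_isomorphisms_imp_iso)
qed

text \<open>Each splitting along a factor C_2 squares the unit group; here this becomes doubling of
  both exponents, leading from (2, 1) through (4, 2) to (8, 4).\<close>

lemma DirProd_group_power_double:
  assumes "group A" "group B" "group X" "X \<cong> group_power A m \<times>\<times> group_power B n"
  shows "X \<times>\<times> X \<cong> group_power A (m + m) \<times>\<times> group_power B (n + n)"
proof -
  have "X \<times>\<times> X \<cong>
      (group_power A m \<times>\<times> group_power B n) \<times>\<times> (group_power A m \<times>\<times> group_power B n)"
    using assms by (intro group.DirProd_iso_trans)
  also have "\<dots> \<cong>
      (group_power A m \<times>\<times> group_power A m) \<times>\<times> (group_power B n \<times>\<times> group_power B n)"
    by (rule DirProd_interchange_iso)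
  also have "\<dots> \<cong> group_power A (m + m) \<times>\<times> group_power B (n + n)"
    using assms by (intro group.DirProd_iso_trans group_power_add_iso DirProd_group group_group_power)
  finally show ?thesis .
qed

section \<open>Units of the group algebra of D_12 x C_2\<close>

theorem theorem2p12:
  fixes p k q :: nat
  assumes "CHAR('f::{field,finite}) = p"
    and "CARD('f) = q" and "q = p ^ k"
    and "p > 3"
    and "[int q = 1] (mod 6) \<or> [int q = - 1] (mod 6)"
  shows "units_of (group_algebra TYPE('f) (dihedral_group 12 \<times>\<times> integer_mod_group 2)) \<cong>
           group_power (integer_mod_group (p ^ k - 1)) 8 \<times>\<times>
           group_power (general_linear_group TYPE('f) 2) 4"
proof -
  \<comment> \<open>If 2 or 3 vanished in the field, the characteristic \<open>p\<close> would
    divide it, contradicting p > 3.\<close>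
  have two: "(2 :: 'f) \<noteq> 0" and three: "(3 :: 'f) \<noteq> 0"
    using assms(1,4) of_nat_eq_0_iff_char_dvd[of 2, where 'a = 'f]
      of_nat_eq_0_iff_char_dvd[of 3, where 'a = 'f] by (auto dest: dvd_imp_le)
  let ?C = "integer_mod_group (p ^ k - 1)" and ?GL = "general_linear_group TYPE('f) 2"
  let ?D = dihedral_group and ?Z = "integer_mod_group 2" and ?F = "field_ring TYPE('f)"
  let ?A = "group_algebra TYPE('f) :: (int \<times> bool) monoid \<Rightarrow> _"
  let ?M = "ring_mat TYPE('f) 2 ()"
  have monoid_A: "monoid (group_algebra TYPE('f) G)" if "group G" "finite (carrier G)"
    for G :: "('g, 'm) monoid_scheme"
    using ring_group_algebra[OF that] by (rule ring.is_monoid)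
  have fin: "finite (carrier (?D n))" for n by (simp add: carrier_dihedral_group)
  have finZ: "finite (carrier ?Z)" by (simp add: carrier_integer_mod_group)
  have D: "group (?D 6)" "group (?D 12)" by (simp_all add: group_dihedral_group)
  have monoid_F: "monoid ?F" and monoid_M: "monoid ?M"
    using field_field_ring[of "TYPE('f)"] ring_mat[where 'a = 'f and n = 2 and b = "()"]
    by (simp_all add: cring.axioms(1) domain.axioms(1) field.axioms(1) ring.is_monoid)
  have grp_GL: "group ?GL"
    unfolding general_linear_group_def by (rule monoid.units_group[OF monoid_M])
  have grp_F: "group (units_of ?F)" by (rule monoid.units_group[OF monoid_F])
  have iso_F: "units_of ?F \<cong> ?C"
    using units_of_field_ring_iso[where 'f = 'f] assms(2,3) by simp
  have "?C \<times>\<times> ?C \<cong> group_power ?C 1 \<times>\<times> group_power ?C 1"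
    by (intro group.DirProd_iso_trans group_power_1_iso group_integer_mod_group)
  also have "\<dots> \<cong> group_power ?C (1 + 1)"
    by (rule group_power_add_iso)
  finally have C2: "?C \<times>\<times> ?C \<cong> group_power ?C 2"
    by (simp add: numeral_2_eq_2)
  \<comment> \<open>Used twice: for \<open>?D 6\<close>, after rewriting \<open>?D 12\<close> as
    \<open>?D 6\<close> times C_2, and for \<open>?D 12\<close> itself.\<close>
  have split: "units_of (group_algebra TYPE('f) (G \<times>\<times> ?Z)) \<cong>
      units_of (group_algebra TYPE('f) G) \<times>\<times> units_of (group_algebra TYPE('f) G)"
    if "group G" "finite (carrier G)" for G :: "('g, 'm) monoid_scheme"
    using units_of_iso[OF _ _ group_algebra_DirProd_C2[OF that(1) two]] that finZ
    by (simp add: units_of_DirProd monoid_A DirProd_group DirProd_monoid)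
  have "units_of (?A (?D 6)) \<cong> (units_of ?F \<times>\<times> units_of ?F) \<times>\<times> ?GL"
    using units_of_iso[OF _ _ group_algebra_D6[OF two three]] monoid_F monoid_M
    by (simp add: units_of_DirProd monoid_A D fin DirProd_monoid general_linear_group_def)
  also have "\<dots> \<cong> (?C \<times>\<times> ?C) \<times>\<times> ?GL"
    by (intro group.DirProd_iso_trans DirProd_group grp_F iso_F iso_refl)
  also have "\<dots> \<cong> group_power ?C 2 \<times>\<times> group_power ?GL 1"
    by (intro group.DirProd_iso_trans DirProd_group C2 group_power_1_iso group_integer_mod_group)
  finally have U6: "units_of (?A (?D 6)) \<cong> group_power ?C 2 \<times>\<times> group_power ?GL 1" .
  have grp_U6: "group (units_of (?A (?D 6)))" and grp_U12: "group (units_of (?A (?D 12)))"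
    by (simp_all add: monoid.units_group monoid_A D fin)
  have "?D 12 \<cong> ?D 6 \<times>\<times> ?Z"
    using dihedral_group_iso_DirProd_C2[of 3] by simp
  then have "units_of (?A (?D 12)) \<cong> units_of (group_algebra TYPE('f) (?D 6 \<times>\<times> ?Z))"
    by (intro units_of_iso group_algebra_cong monoid_A) (simp_all add: D fin finZ DirProd_group)
  also have "\<dots> \<cong> units_of (?A (?D 6)) \<times>\<times> units_of (?A (?D 6))"
    by (rule split) (simp_all add: D fin)
  also have "\<dots> \<cong> group_power ?C 4 \<times>\<times> group_power ?GL 2"
    using DirProd_group_power_double[OF group_integer_mod_group grp_GL grp_U6 U6]
    by (simp only: one_add_one numeral_plus_numeral add_num_simps)
  finally have U12: "units_of (?A (?D 12)) \<cong> group_power ?C 4 \<times>\<times> group_power ?GL 2" .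
  have "units_of (group_algebra TYPE('f) (?D 12 \<times>\<times> ?Z)) \<cong>
      units_of (?A (?D 12)) \<times>\<times> units_of (?A (?D 12))"
    by (rule split) (simp_all add: D fin)
  also have "\<dots> \<cong> group_power ?C 8 \<times>\<times> group_power ?GL 4"
    using DirProd_group_power_double[OF group_integer_mod_group grp_GL grp_U12 U12]
    by (simp only: one_add_one numeral_plus_numeral add_num_simps)
  finally show ?thesis .
qed

end
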